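(* For every irrational $\theta\in(0,1)$, $$\dim_H\mathcal U_1[\theta]\ge\frac{1}{w(\theta)+1},$$ with the convention $1/(\infty+1)=0$.
   Context: $\mathbb T=\mathbb R/\mathbb Z$; points identified with fractional parts. $\|t\|$ is the distance from $t$ to the nearest integer. $w(\theta)=\sup\{s>0:\liminf_{j\to\infty}j^s\|j\theta\|=0\}$. $\mathcal U_1[\theta]$ is the set of $y\in\mathbb T$ such that there exists $Q_0$ with: for every real $Q\ge Q_0$ there is an integer $1\le n\le Q$ with $\|n\theta-y\|<Q^{-1}$. *)

theory Defs
  imports "HOL-Analysis.Analysis" "HOL-Library.Extended_Real"
begin

definition dnint :: "real \<Rightarrow> real" where
  "dnint t = \<bar>t - of_int (round t)\<bar>"

definition irr_exp :: "real \<Rightarrow> ereal" where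
  "irr_exp \<theta> = Sup {ereal s | s. s > 0 \<and>
      Liminf sequentially (\<lambda>j::nat. ereal (real j powr s * dnint (real j * \<theta>))) = 0}"

(* U_1[theta], points of T identified with their representatives in [0,1) *)
definition U1 :: "real \<Rightarrow> real set" where
  "U1 \<theta> = {y \<in> {0..<1}. \<exists>Q0::real. \<forall>Q::real. Q \<ge> Q0 \<longrightarrow>
      (\<exists>n::nat. 1 \<le> n \<and> real n \<le> Q \<and> dnint (real n * \<theta> - y) < 1 / Q)}"

definition hausdorff_content :: "real \<Rightarrow> real \<Rightarrow> real set \<Rightarrow> ennreal" where
  "hausdorff_content s \<delta> A = Inf {(\<Sum>i. ennreal (diameter (C i) powr s)) | C :: nat \<Rightarrow> real set.
      (\<forall>i. bounded (C i) \<and> diameter (C i) \<le> \<delta>) \<and> A \<subseteq> (\<Union>i. C i)}"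

definition hausdorff_measure :: "real \<Rightarrow> real set \<Rightarrow> ennreal" where
  "hausdorff_measure s A = (SUP \<delta>\<in>{0<..}. hausdorff_content s \<delta> A)"

definition hausdorff_dim :: "real set \<Rightarrow> real" where
  "hausdorff_dim A = Inf {s. s > 0 \<and> hausdorff_measure s A = 0}"

end

(* The distances d k = |q_k theta - p_k| at the convergents satisfy d (k-1) = a d k + d (k+1), and a point y
   lies in U_1[theta] once every range q_(k+1) <= Q < q_(k+2) supplies an n. Cut the circle at
   theta, 2 theta, ..., q_(k+1) theta: each gap of level k is subdivided by the points of level k+1 into about a_k
   gaps, and every y in the c-th of them is reached for all Q of that range as soon as the product
   (c+1-b)(b+2) stays below a_k for 1 <= b < c, i.e. for c up to about 2 sqrt(a_k). Hence, with the weight of a gap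
   equal to the square root of its length, the good subgaps of a gap always weigh at least as much as the gap.
   This is tight for small a_k: there one also needs the last, longer subgap, or its truncation to length
   d (k+1), which only gets half of the square-root weight.

   Let sets C_i of diameter r_i cover U_1[theta], and give each C_i a level k_i. Sum the clamped linear functions
   with slope 1/sqrt(d k_i) supported near C_i. If the total increment is below the weight of a starting gap, then
   some good child always has an increment below its weight, so one can descend forever without meeting
   any C_i and arrives at an uncovered point of U_1[theta]. The cost of C_i is about
   min(sqrt(d k), r_i / sqrt(d (k+1))) for d (k+1) <= r_i < d k, which is O(r_i^s) with s = 1/(1+w) when
   d (k+1) >= c (d k)^w. *)

theory Submission
  imports Defs
begin

section \<open>Continued fraction expansion\<close>

text \<open>
Indices are shifted by one against the usual convention: \<open>cf_den \<theta> 0 = 0\<close> and \<open>cf_num \<theta> 0 = 1\<close>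
belong to the formal convergent \<open>1/0\<close>.
\<close>

fun cf_err :: "real \<Rightarrow> nat \<Rightarrow> real" where
  "cf_err \<theta> 0 = 1"
| "cf_err \<theta> (Suc 0) = \<theta>"
| "cf_err \<theta> (Suc (Suc k)) = cf_err \<theta> k - of_int \<lfloor>cf_err \<theta> k / cf_err \<theta> (Suc k)\<rfloor> * cf_err \<theta> (Suc k)"

definition cf_quot :: "real \<Rightarrow> nat \<Rightarrow> nat" where
  "cf_quot \<theta> k = nat \<lfloor>cf_err \<theta> k / cf_err \<theta> (Suc k)\<rfloor>"

fun cf_den :: "real \<Rightarrow> nat \<Rightarrow> nat" where
  "cf_den \<theta> 0 = 0"
| "cf_den \<theta> (Suc 0) = 1"
| "cf_den \<theta> (Suc (Suc k)) = cf_quot \<theta> k * cf_den \<theta> (Suc k) + cf_den \<theta> k"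

fun cf_num :: "real \<Rightarrow> nat \<Rightarrow> nat" where
  "cf_num \<theta> 0 = 1"
| "cf_num \<theta> (Suc 0) = 0"
| "cf_num \<theta> (Suc (Suc k)) = cf_quot \<theta> k * cf_num \<theta> (Suc k) + cf_num \<theta> k"

lemma dnint_le: "dnint t \<le> \<bar>t - of_int z\<bar>"
  unfolding dnint_def by (rule round_diff_minimal)

lemma dnint_nonneg: "0 \<le> dnint t"
  unfolding dnint_def by simp

locale irrational_rotation =
  fixes \<theta> :: real
  assumes irrational: "\<theta> \<notin> \<rat>" and theta_pos: "0 < \<theta>" and theta_less_1: "\<theta> < 1"
begin

abbreviation "d \<equiv> cf_err \<theta>"
abbreviation "a \<equiv> cf_quot \<theta>"
abbreviation "q \<equiv> cf_den \<theta>"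
abbreviation "p \<equiv> cf_num \<theta>"

lemma irrational_lin_nz:
  assumes "n \<ge> 1"
  shows "real n * \<theta> - real m \<noteq> 0"
proof
  assume "real n * \<theta> - real m = 0"
  then have "\<theta> = real m / real n" using assms by (simp add: field_simps)
  then show False using irrational by (metis Rats_divide Rats_of_nat)
qed

text \<open>Identities and inequalities need one joint induction. The floor only makes the new
  remainder nonnegative; it is nonzero because, up to sign, it equals q \<theta> - p with q \<ge> 1
  and \<theta> irrational.\<close>

lemma cf_invariant:
  "0 < d (Suc k) \<and> d (Suc k) < d k
    \<and> real (q k) * \<theta> - real (p k) = - ((-1)^k * d k)
    \<and> real (q (Suc k)) * \<theta> - real (p (Suc k)) = (-1)^k * d (Suc k) \<and> 1 \<le> q (Suc k)"
proof (induction k)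
  case 0
  then show ?case using theta_pos theta_less_1 by simp
next
  case (Suc k)
  let ?x = "d k / d (Suc k)"
  have pos: "0 < d (Suc k)" and lt: "d (Suc k) < d k" using Suc by auto
  have x1: "1 < ?x" using pos lt by simp
  then have f1: "1 \<le> \<lfloor>?x\<rfloor>" by linarith
  have ak: "real (a k) = of_int \<lfloor>?x\<rfloor>" using f1 unfolding cf_quot_def by simp
  have a1: "1 \<le> a k" using f1 unfolding cf_quot_def by linarith
  have dk: "d (Suc (Suc k)) = d k - real (a k) * d (Suc k)" by (simp add: ak)
  have "real (a k) \<le> ?x" "?x < real (a k) + 1" unfolding ak by linarith+
  then have "real (a k) * d (Suc k) \<le> d k" "d k < (real (a k) + 1) * d (Suc k)"
    using pos by (simp_all add: field_simps)
  then have b: "0 \<le> d (Suc (Suc k))" "d (Suc (Suc k)) < d (Suc k)"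
    unfolding dk by (simp_all add: algebra_simps)
  have "real (q (Suc (Suc k))) * \<theta> - real (p (Suc (Suc k))) =
    real (a k) * (real (q (Suc k)) * \<theta> - real (p (Suc k))) + (real (q k) * \<theta> - real (p k))"
    by (simp add: algebra_simps)
  also have "\<dots> = real (a k) * ((-1)^k * d (Suc k)) - (-1)^k * d k"
    using Suc by simp
  also have "\<dots> = - ((-1)^k * d (Suc (Suc k)))" unfolding dk by (simp add: algebra_simps)
  finally have e: "real (q (Suc (Suc k))) * \<theta> - real (p (Suc (Suc k))) = (-1)^Suc k * d (Suc (Suc k))"
    by simp
  have q1: "1 \<le> q (Suc (Suc k))" using a1 Suc by (simp add: Suc_le_eq)
  have "d (Suc (Suc k)) \<noteq> 0" using irrational_lin_nz[OF q1, of "p (Suc (Suc k))"] e by auto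
  then show ?case using b e q1 Suc by auto
qed

lemma d_pos [simp]: "0 < d k"
  using cf_invariant[of k] by simp

lemma d_Suc_less: "d (Suc k) < d k"
  using cf_invariant[of k] by simp

lemma den_err: "real (q k) * \<theta> - real (p k) = - ((-1)^k * d k)"
  using cf_invariant[of k] by simp

lemma den_pos: "1 \<le> q (Suc k)"
  using cf_invariant[of k] by simp

lemma quot_pos: "1 \<le> a k"
proof -
  have "1 < d k / d (Suc k)" using d_Suc_less[of k] by simp
  then have "1 \<le> \<lfloor>d k / d (Suc k)\<rfloor>" by linarith
  then show ?thesis unfolding cf_quot_def by linarith
qed

lemma d_rec: "d k = real (a k) * d (Suc k) + d (Suc (Suc k))"
proof -
  have "0 \<le> \<lfloor>d k / d (Suc k)\<rfloor>" by (simp add: less_imp_le)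
  then show ?thesis by (simp add: cf_quot_def)
qed

lemma den_le_Suc: "q k \<le> q (Suc k)"
proof (cases k)
  case (Suc j)
  have "q (Suc j) \<le> a j * q (Suc j)" using quot_pos[of j] by (cases "a j") auto
  then show ?thesis unfolding Suc cf_den.simps by (rule trans_le_add1)
qed simp

text \<open>Geometrically, the circle has length 1: the points \<theta>, ...,
  \<open>q (Suc k)\<close> \<theta> leave \<open>q (Suc k)\<close> gaps of length
  \<open>d k\<close>, of which \<open>q k\<close> are longer by \<open>d (Suc k)\<close>. The
  induction itself uses only the two recurrences.\<close>

lemma den_err_product: "real (q (Suc k)) * d k + real (q k) * d (Suc k) = 1"
proof (induction k)
  case (Suc k)
  then show ?case using d_rec[of k] by (simp del: cf_err.simps add: algebra_simps)
qed simp

lemma den_d_le: "real (q (Suc k)) * d k \<le> 1"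
proof -
  have "0 \<le> real (q k) * d (Suc k)" by (simp add: less_imp_le)
  then show ?thesis using den_err_product[of k] by linarith
qed

text \<open>A crude growth bound: it makes \<open>d\<close> tend to 0 and lets the ranges between
  consecutive denominators exhaust all large Q.\<close>

lemma den_ge: "k \<le> q (Suc k)"
proof (induction k)
  case (Suc k)
  show ?case
  proof (cases k)
    case 0
    then show ?thesis using den_pos[of 1] by simp
  next
    case (Suc j)
    have "q (Suc k) \<le> a k * q (Suc k)" using quot_pos[of k] by (cases "a k") auto
    moreover have "1 \<le> q k" using den_pos[of j] Suc by simp
    ultimately show ?thesis using Suc.IH unfolding cf_den.simps by linarith
  qed
qed simp

lemma d_tendsto_0: "d \<longlonglongrightarrow> 0"
proof (rule Lim_null_comparison)
  show "\<forall>\<^sub>F k in sequentially. norm (d k) \<le> inverse (real k)"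
  proof (rule eventually_sequentiallyI[of 1])
    fix k :: nat assume k: "1 \<le> k"
    have "real k * d k \<le> real (q (Suc k)) * d k"
      using den_ge[of k] by (intro mult_right_mono) (auto simp: less_imp_le)
    also have "\<dots> \<le> 1" by (rule den_d_le)
    finally show "norm (d k) \<le> inverse (real k)"
      using k less_imp_le[OF d_pos[of k]] by (simp add: field_simps)
  qed
  show "(\<lambda>k. inverse (real k)) \<longlonglongrightarrow> 0" by (rule lim_inverse_n)
qed

end

declare cf_err.simps(3) [simp del] cf_den.simps(3) [simp del] cf_num.simps(3) [simp del]

section \<open>Points reached between two consecutive denominators\<close>

lemma interval_step_exists:
  fixes f :: "nat \<Rightarrow> real"
  assumes "f 0 \<le> x" "x < f c"
  obtains b where "b < c" "f b \<le> x" "x < f (Suc b)"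
  using assms
proof (induction c arbitrary: thesis)
  case (Suc c)
  show ?case
  proof (cases "x < f c")
    case True
    then obtain b where "b < c" "f b \<le> x" "x < f (Suc b)" using Suc.IH Suc.prems by blast
    then show ?thesis using Suc.prems(1)[of b] by simp
  next
    case False
    then show ?thesis using Suc.prems(1)[of c] Suc.prems(3) by simp
  qed
qed simp

text \<open>Here A counts the subgaps, and c, starting at 0, numbers one of them. Its points lie at
  most c + 1 - b short steps beyond the division point b, which has to serve while Q stays below
  roughly b + 2 denominators. The value b = 0 is left out since both ends of the gap help there, and
  b = c since one short step is always close enough.\<close>

definition good_index :: "nat \<Rightarrow> nat \<Rightarrow> bool" where
  "good_index A c \<longleftrightarrow> (\<forall>b. 1 \<le> b \<and> b < c \<longrightarrow> (c + 1 - b) * (b + 2) \<le> A)"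

context irrational_rotation
begin

text \<open>A lift of a circle point to the real line, so that gaps are ordinary intervals without
  wraparound.\<close>

definition orbit_point :: "nat \<Rightarrow> real \<Rightarrow> bool" where
  "orbit_point m P \<longleftrightarrow> (\<exists>z::int. P = real m * \<theta> - of_int z)"

definition fan :: "nat \<Rightarrow> nat \<Rightarrow> nat" where
  "fan k m = a k + (if m \<le> q k then 1 else 0)"

text \<open>
The gap at a point of index \<open>m\<close> is long, with one more subgap, exactly if \<open>m \<le> q k\<close>;
\<open>fan k m\<close> is the number of its subgaps.
\<close>

definition gap :: "nat \<Rightarrow> nat \<Rightarrow> real" where
  "gap k m = real (fan k m) * d (Suc k) + d (Suc (Suc k))"

definition reached :: "nat \<Rightarrow> real \<Rightarrow> bool" where
  "reached k y \<longleftrightarrow> (\<forall>Q. real (q (Suc k)) \<le> Q \<and> Q < real (q (Suc (Suc k))) \<longrightarrow>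
     (\<exists>n. 1 \<le> n \<and> real n \<le> Q \<and> dnint (real n * \<theta> - y) < 1 / Q))"

lemma reach_witness:
  assumes "orbit_point n R" "1 \<le> n" "real n \<le> Q" "\<bar>R - y\<bar> * Q < 1"
  shows "\<exists>n. 1 \<le> n \<and> real n \<le> Q \<and> dnint (real n * \<theta> - y) < 1 / Q"
proof -
  obtain z where z: "R = real n * \<theta> - of_int z"
    using assms(1) unfolding orbit_point_def by blast
  have "dnint (real n * \<theta> - y) \<le> \<bar>(real n * \<theta> - y) - of_int z\<bar>" by (rule dnint_le)
  also have "\<dots> = \<bar>R - y\<bar>" unfolding z by (simp add: algebra_simps)
  also have "\<dots> < 1 / Q" using assms by (simp add: field_simps)
  finally show ?thesis using assms by blast
qed

lemma gap_eq: "gap k m = (if m \<le> q k then d k + d (Suc k) else d k)"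
  using d_rec[of k] unfolding gap_def fan_def by (simp add: algebra_simps)

lemma fan_pos: "1 \<le> fan k m"
  using quot_pos[of k] unfolding fan_def by simp

text \<open>Crossing a long gap shifts the index by \<open>q (Suc k) - q k\<close>, crossing a short
  one by \<open>- q k\<close>. The condition m \<le> \<open>q k\<close> is exactly what keeps the
  new index in range.\<close>

lemma orbit_point_far_end:
  assumes "1 \<le> m" "m \<le> q (Suc k)" "orbit_point m P"
  obtains m' where "1 \<le> m'" "m' \<le> q (Suc k)" "orbit_point m' (P + (-1)^k * gap k m)"
proof -
  obtain z where z: "P = real m * \<theta> - of_int z"
    using assms(3) unfolding orbit_point_def by blast
  note e = den_err[of k] den_err[of "Suc k"]
  show ?thesis
  proof (cases "m \<le> q k")
    case True
    let ?m = "m + q (Suc k) - q k"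
    have le: "q k \<le> q (Suc k)" by (rule den_le_Suc)
    have r: "real ?m = real m + real (q (Suc k)) - real (q k)" using le by (simp add: of_nat_diff)
    have "P + (-1)^k * gap k m = real ?m * \<theta> - of_int (z + int (p (Suc k)) - int (p k))"
      using e True unfolding gap_eq z r by (simp add: algebra_simps)
    moreover have "1 \<le> ?m" "?m \<le> q (Suc k)" using True le assms by auto
    ultimately show ?thesis using that[of ?m] unfolding orbit_point_def by blast
  next
    case False
    let ?m = "m - q k"
    have r: "real ?m = real m - real (q k)" using False by simp
    have "P + (-1)^k * gap k m = real ?m * \<theta> - of_int (z - int (p k))"
      using e False unfolding gap_eq z r by (simp add: algebra_simps)
    moreover have "1 \<le> ?m" "?m \<le> q (Suc k)" using False assms by auto
    ultimately show ?thesis using that[of ?m] unfolding orbit_point_def by blast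
  qed
qed

lemma orbit_point_inner:
  assumes "orbit_point m P"
  shows "orbit_point (m + b * q (Suc k)) (P + (-1)^k * (real b * d (Suc k)))"
proof -
  obtain z where z: "P = real m * \<theta> - of_int z"
    using assms unfolding orbit_point_def by blast
  have "(-1)^k * (real b * d (Suc k)) = real b * (real (q (Suc k)) * \<theta> - real (p (Suc k)))"
    using den_err[of "Suc k"] by simp
  then have "P + (-1)^k * (real b * d (Suc k))
      = real (m + b * q (Suc k)) * \<theta> - of_int (z + int (b * p (Suc k)))"
    unfolding z by (simp add: algebra_simps)
  then show ?thesis unfolding orbit_point_def by blast
qed

text \<open>This accounts for the extra 1 in \<open>fan\<close>: as \<open>q (Suc (Suc k))\<close>
  is \<open>a k\<close> copies of \<open>q (Suc k)\<close> plus \<open>q k\<close>, an index m \<le>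
  \<open>q k\<close> leaves room for one more copy.\<close>

lemma inner_index_le:
  assumes "m \<le> q (Suc k)" "b + 1 \<le> fan k m"
  shows "m + b * q (Suc k) \<le> q (Suc (Suc k))"
proof (cases "m \<le> q k")
  case True
  then have "b * q (Suc k) \<le> a k * q (Suc k)"
    using assms by (intro mult_right_mono) (auto simp: fan_def)
  then show ?thesis using True unfolding cf_den.simps by linarith
next
  case False
  then have "(b + 1) * q (Suc k) \<le> a k * q (Suc k)"
    using assms by (intro mult_right_mono) (auto simp: fan_def)
  then show ?thesis using assms unfolding cf_den.simps by (simp add: algebra_simps)
qed

text \<open>A point at distance at most \<open>d (Suc k)\<close> from y serves the whole rest of the
  range, because \<open>d (Suc k) * q (Suc (Suc k))\<close> is at most 1.\<close>

lemma unit_bound: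
  assumes "0 \<le> u" "u \<le> d (Suc k)" "0 \<le> Q" "Q < real (q (Suc (Suc k)))"
  shows "u * Q < 1"
proof -
  have "u * Q \<le> d (Suc k) * Q" using assms by (intro mult_right_mono) auto
  also have "\<dots> < d (Suc k) * real (q (Suc (Suc k)))" using assms by (intro mult_strict_left_mono) auto
  also have "\<dots> \<le> 1" using den_d_le[of "Suc k"] by (simp only: mult.commute)
  finally show ?thesis .
qed

text \<open>For u \<le> \<open>d (Suc k)\<close> the previous bound applies. Otherwise, in a short
  gap, Q is below (b + 2) \<open>q (Suc k)\<close> and \<open>den_d_le\<close> finishes. In a long
  gap m \<le> \<open>q k\<close> saves \<open>q (Suc k) - q k\<close> copies of u; as u exceeds
  \<open>d (Suc k)\<close>, this saving reduces the bound to \<open>den_err_product\<close>, which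
  gives exactly 1.\<close>

lemma product_bound:
  assumes m: "m \<le> q (Suc k)" and b: "b + 2 \<le> fan k m" and Q: "0 \<le> Q" "Q < real (m + Suc b * q (Suc k))"
    and u: "0 \<le> u" "u * (real b + 2) \<le> gap k m"
  shows "u * Q < 1"
proof (cases "u \<le> d (Suc k)")
  case True
  have "m + Suc b * q (Suc k) \<le> q (Suc (Suc k))" using inner_index_le[OF m, of "Suc b"] b by simp
  then have "Q < real (q (Suc (Suc k)))" using Q by linarith
  then show ?thesis using unit_bound u Q True by blast
next
  case False
  then have u': "d (Suc k) < u" by simp
  have pos: "0 < u" using u' d_pos[of "Suc k"] by linarith
  have "u * Q < u * real (m + Suc b * q (Suc k))" using Q pos by simp
  also have "\<dots> \<le> 1"
  proof (cases "m \<le> q k")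
    case False
    have "u * real (m + Suc b * q (Suc k)) \<le> u * real (q (Suc k) + Suc b * q (Suc k))"
      using m pos by (intro mult_left_mono) auto
    also have "\<dots> = (u * (real b + 2)) * real (q (Suc k))" by (simp add: algebra_simps)
    also have "\<dots> \<le> d k * real (q (Suc k))"
      using u False unfolding gap_eq by (intro mult_right_mono) auto
    also have "\<dots> \<le> 1" using den_d_le[of k] by (simp add: mult.commute)
    finally show ?thesis .
  next
    case True
    have le: "0 \<le> real (q (Suc k)) - real (q k)" using den_le_Suc[of k] by simp
    have "u * real (m + Suc b * q (Suc k)) \<le> u * real (q k + Suc b * q (Suc k))"
      using True pos by (intro mult_left_mono) auto
    also have "\<dots> = (u * (real b + 2)) * real (q (Suc k)) - u * (real (q (Suc k)) - real (q k))"
      by (simp add: algebra_simps)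
    also have "\<dots> \<le> (d k + d (Suc k)) * real (q (Suc k)) - d (Suc k) * (real (q (Suc k)) - real (q k))"
      using u u' True le unfolding gap_eq by (intro diff_mono mult_right_mono) auto
    also have "\<dots> = 1" using den_err_product[of k] by (simp add: algebra_simps)
    finally show ?thesis .
  qed
  finally show ?thesis .
qed

lemma reach_from_inner:
  assumes "orbit_point m P" "1 \<le> m" "real (m + b * q (Suc k)) \<le> Q"
    "\<bar>x - real b * d (Suc k)\<bar> * Q < 1"
  shows "\<exists>n. 1 \<le> n \<and> real n \<le> Q \<and> dnint (real n * \<theta> - (P + (-1)^k * x)) < 1 / Q"
proof (rule reach_witness[OF orbit_point_inner[OF assms(1)] _ assms(3)])
  have "\<bar>P + (-1)^k * (real b * d (Suc k)) - (P + (-1)^k * x)\<bar> = \<bar>(-1)^k * (real b * d (Suc k) - x)\<bar>"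
    by (simp add: algebra_simps)
  then show "\<bar>P + (-1)^k * (real b * d (Suc k)) - (P + (-1)^k * x)\<bar> * Q < 1"
    using assms(4) by (simp add: abs_mult power_abs abs_minus_commute)
qed (use assms in auto)

lemma reach_from_far_end:
  assumes "orbit_point m P" "1 \<le> m" "m \<le> q (Suc k)" "real (q (Suc k)) \<le> Q"
    "\<bar>gap k m - x\<bar> * Q < 1"
  shows "\<exists>n. 1 \<le> n \<and> real n \<le> Q \<and> dnint (real n * \<theta> - (P + (-1)^k * x)) < 1 / Q"
proof -
  obtain m' where m': "1 \<le> m'" "m' \<le> q (Suc k)" "orbit_point m' (P + (-1)^k * gap k m)"
    using orbit_point_far_end assms by blast
  have "\<bar>P + (-1)^k * gap k m - (P + (-1)^k * x)\<bar> = \<bar>(-1)^k * (gap k m - x)\<bar>"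
    by (simp add: algebra_simps)
  then have "\<bar>P + (-1)^k * gap k m - (P + (-1)^k * x)\<bar> * Q < 1"
    using assms(5) by (simp add: abs_mult power_abs)
  moreover have "real m' \<le> Q" using m' assms by linarith
  ultimately show ?thesis using reach_witness m' by blast
qed

text \<open>Both ends of the gap have indices at most \<open>q (Suc k)\<close>, hence are available,
  and the nearer one is within half the gap: this is \<open>product_bound\<close> with b =
  0.\<close>

lemma reach_before_first:
  assumes "orbit_point m P" "1 \<le> m" "m \<le> q (Suc k)" "2 \<le> fan k m"
    "real (q (Suc k)) \<le> Q" "Q < real (m + q (Suc k))" "0 \<le> x" "x \<le> gap k m"
  shows "\<exists>n. 1 \<le> n \<and> real n \<le> Q \<and> dnint (real n * \<theta> - (P + (-1)^k * x)) < 1 / Q"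
proof (cases "x * 2 \<le> gap k m")
  case True
  then have "x * Q < 1" using product_bound[of m k 0 Q x] assms by simp
  then show ?thesis using reach_from_inner[of m P 0 k Q x] assms by simp
next
  case False
  then have "(gap k m - x) * Q < 1" using product_bound[of m k 0 Q "gap k m - x"] assms by simp
  then show ?thesis using reach_from_far_end[of m P k Q x] assms by simp
qed

text \<open>The last division point b \<le> c already available at Q is used: for b = c it is one
  short step away, for 1 \<le> b < c the goodness of c enters, and for b = 0 the far end of the gap
  may replace it.\<close>

lemma reached_short:
  assumes P: "orbit_point m P" "1 \<le> m" "m \<le> q (Suc k)" and c: "c + 2 \<le> fan k m" "good_index (fan k m) c"
    and x: "real c * d (Suc k) \<le> x" "x \<le> (real c + 1) * d (Suc k)"
  shows "reached k (P + (-1)^k * x)"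
  unfolding reached_def
proof (intro allI impI)
  fix Q :: real
  assume Q: "real (q (Suc k)) \<le> Q \<and> Q < real (q (Suc (Suc k)))"
  let ?f = "\<lambda>b. real (m + b * q (Suc k))"
  have Q0: "0 \<le> Q" using Q by linarith
  have x0: "0 \<le> x" using x(1) d_pos[of "Suc k"] by (meson less_imp_le mult_nonneg_nonneg of_nat_0_le_iff order_trans)
  have "(real c + 1) * d (Suc k) \<le> real (fan k m) * d (Suc k)" using c by (intro mult_right_mono) (auto simp: less_imp_le)
  then have xg: "x \<le> gap k m" using x d_pos[of "Suc (Suc k)"] unfolding gap_def by linarith
  show "\<exists>n. 1 \<le> n \<and> real n \<le> Q \<and> dnint (real n * \<theta> - (P + (-1)^k * x)) < 1 / Q"
  proof (cases "?f c \<le> Q")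
    case True
    have "(x - real c * d (Suc k)) * Q < 1"
      using Q Q0 x by (intro unit_bound[of _ k]) (auto simp: algebra_simps)
    then show ?thesis using reach_from_inner[OF P(1,2) True] x by simp
  next
    case False
    then obtain b where b: "b < c" "?f b \<le> Q" "Q < ?f (Suc b)"
      using interval_step_exists[of ?f Q c] Q P by auto
    show ?thesis
    proof (cases "b = 0")
      case True
      then show ?thesis using reach_before_first[OF P] b Q c x0 xg by simp
    next
      case False
      have "(c + 1 - b) * (b + 2) \<le> fan k m" using c b False unfolding good_index_def by simp
      then have "real (c + 1 - b) * (real b + 2) \<le> real (fan k m)"
        by (metis of_nat_add of_nat_le_iff of_nat_mult of_nat_numeral)
      then have "d (Suc k) * (real (c + 1 - b) * (real b + 2)) \<le> d (Suc k) * real (fan k m)"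
        by (intro mult_left_mono) (auto simp: less_imp_le)
      moreover have "(x - real b * d (Suc k)) * (real b + 2) \<le> (real (c + 1 - b) * d (Suc k)) * (real b + 2)"
        using x b by (intro mult_right_mono) (auto simp: algebra_simps of_nat_diff)
      moreover have "(real (c + 1 - b) * d (Suc k)) * (real b + 2) = d (Suc k) * (real (c + 1 - b) * (real b + 2))"
        by (simp only: mult.assoc mult.left_commute)
      ultimately have u: "(x - real b * d (Suc k)) * (real b + 2) \<le> gap k m"
        using d_pos[of "Suc (Suc k)"] unfolding gap_def mult.commute[of "real (fan k m)"] by linarith
      have "real b * d (Suc k) \<le> real c * d (Suc k)" using b by (intro mult_right_mono) (auto simp: less_imp_le)
      then have "0 \<le> x - real b * d (Suc k)" using x by linarith
      then have "(x - real b * d (Suc k)) * Q < 1" "0 \<le> x - real b * d (Suc k)"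
        using product_bound[OF P(3) _ Q0 b(3) _ u] c b by auto
      then show ?thesis using reach_from_inner[OF P(1,2) b(2)] by simp
    qed
  qed
qed

lemma reached_truncated:
  assumes P: "orbit_point m P" "1 \<le> m" "m \<le> q (Suc k)"
    and x: "gap k m - d (Suc k) \<le> x" "x \<le> gap k m"
  shows "reached k (P + (-1)^k * x)"
  unfolding reached_def
proof (intro allI impI)
  fix Q :: real
  assume Q: "real (q (Suc k)) \<le> Q \<and> Q < real (q (Suc (Suc k)))"
  then have "(gap k m - x) * Q < 1"
    using x by (intro unit_bound[of _ k]) linarith+
  then show "\<exists>n. 1 \<le> n \<and> real n \<le> Q \<and> dnint (real n * \<theta> - (P + (-1)^k * x)) < 1 / Q"
    using reach_from_far_end[OF P] Q x by simp
qed

text \<open>The last subgap is shorter than two short steps, so each point is within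
  \<open>d (Suc k)\<close> of one of its ends. Only the near end may come late; with at most two
  subgaps it is then the first division point, and \<open>reach_before_first\<close> covers the
  waiting time.\<close>

lemma reached_long:
  assumes P: "orbit_point m P" "1 \<le> m" "m \<le> q (Suc k)" and A: "fan k m \<le> 2"
    and x: "gap k m - (d (Suc k) + d (Suc (Suc k))) \<le> x" "x \<le> gap k m"
  shows "reached k (P + (-1)^k * x)"
  unfolding reached_def
proof (intro allI impI)
  fix Q :: real
  assume Q: "real (q (Suc k)) \<le> Q \<and> Q < real (q (Suc (Suc k)))"
  let ?b = "fan k m - 1"
  have rb: "real ?b = real (fan k m) - 1" using fan_pos[of k m] by simp
  have x': "real ?b * d (Suc k) \<le> x" using x unfolding gap_def rb by (simp add: algebra_simps)
  have x0: "0 \<le> x" using x' d_pos[of "Suc k"] by (meson less_imp_le mult_nonneg_nonneg of_nat_0_le_iff order_trans)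
  have Q0: "0 \<le> Q" using Q by linarith
  have dd: "d (Suc (Suc k)) < d (Suc k)" by (rule d_Suc_less)
  show "\<exists>n. 1 \<le> n \<and> real n \<le> Q \<and> dnint (real n * \<theta> - (P + (-1)^k * x)) < 1 / Q"
  proof (cases "real (m + ?b * q (Suc k)) \<le> Q")
    case True
    show ?thesis
    proof (cases "x - real ?b * d (Suc k) \<le> d (Suc k)")
      case True
      then have "(x - real ?b * d (Suc k)) * Q < 1" using Q Q0 x' by (intro unit_bound[of _ k]) linarith+
      then show ?thesis using reach_from_inner[OF P(1,2) \<open>real (m + ?b * q (Suc k)) \<le> Q\<close>] x' by simp
    next
      case False
      then have "gap k m - x \<le> d (Suc k)" using dd unfolding gap_def rb by (simp add: algebra_simps)
      then have "(gap k m - x) * Q < 1" using Q Q0 x by (intro unit_bound[of _ k]) linarith+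
      then show ?thesis using reach_from_far_end[OF P] Q x by simp
    qed
  next
    case False
    have "fan k m \<noteq> 1"
    proof
      assume "fan k m = 1"
      then have "\<not> real m \<le> Q" using False by simp
      then show False using Q P by linarith
    qed
    then have "fan k m = 2" using A fan_pos[of k m] by linarith
    then show ?thesis using reach_before_first[OF P] False Q x x0 by simp
  qed
qed

end

section \<open>Good subgaps outweigh their gap\<close>

lemma good_index_le_1: "c \<le> 1 \<Longrightarrow> good_index A c"
  unfolding good_index_def by auto

text \<open>By the inequality of arithmetic and geometric means, since the two factors always sum to
  c + 3.\<close>

lemma good_index_if_square_le:
  assumes "(c + 3)\<^sup>2 \<le> 4 * A"
  shows "good_index A c"
  unfolding good_index_def
proof (intro allI impI)
  fix b assume b: "1 \<le> b \<and> b < c"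
  have amgm: "4 * (x * y) \<le> (x + y)\<^sup>2" for x y :: nat
  proof -
    have "int (4 * (x * y)) \<le> int ((x + y)\<^sup>2)"
      using zero_le_power2[of "int x - int y"] by (simp add: power2_eq_square algebra_simps)
    then show ?thesis by linarith
  qed
  have "4 * ((c + 1 - b) * (b + 2)) \<le> (c + 1 - b + (b + 2))\<^sup>2" by (rule amgm)
  also have "c + 1 - b + (b + 2) = c + 3" using b by simp
  finally show "(c + 1 - b) * (b + 2) \<le> A" using assms by linarith
qed

lemma nat_sqrt_bounds:
  obtains s :: nat where "s\<^sup>2 \<le> n" "n < (Suc s)\<^sup>2"
proof -
  have "\<exists>s::nat. s\<^sup>2 \<le> n \<and> n < (Suc s)\<^sup>2"
  proof (induction n)
    case 0
    then show ?case by (intro exI[of _ 0]) auto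
  next
    case (Suc n)
    then obtain s :: nat where s: "s\<^sup>2 \<le> n" "n < (Suc s)\<^sup>2" by blast
    show ?case
    proof (cases "Suc n < (Suc s)\<^sup>2")
      case True
      then show ?thesis using s by (intro exI[of _ s]) auto
    next
      case False
      then have "Suc n = (Suc s)\<^sup>2" using s by simp
      then show ?thesis by (intro exI[of _ "Suc s"]) (simp add: power2_eq_square)
    qed
  qed
  then show ?thesis using that by blast
qed

text \<open>The bound on \<open>g\<^sup>2\<close> makes g short subgaps outweigh a gap of length
  below A + 1 short steps, and g < A keeps all of them short. For A from 6 to 8, g = 3 works because
  c = 2 is good precisely from A = 6 on; beyond that g is the integer square root s plus 1, where s
  \<ge> 3 gives c + 3 \<le> 2 s.\<close>

lemma many_good_indices:
  assumes "6 \<le> A"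
  obtains g where "g < A" "A + 1 \<le> g\<^sup>2" "\<And>c. c < g \<Longrightarrow> good_index A c"
proof (cases "A < 9")
  case True
  have "good_index A c" if "c < 3" for c
  proof -
    have "c = 0 \<or> c = 1 \<or> c = 2" using that by auto
    moreover have "good_index A 2" unfolding good_index_def
    proof (intro allI impI)
      fix b :: nat assume "1 \<le> b \<and> b < 2"
      then have "b = 1" by simp
      then show "(2 + 1 - b) * (b + 2) \<le> A" using assms by simp
    qed
    ultimately show ?thesis using good_index_le_1 by auto
  qed
  then show ?thesis using that[of 3] True assms by (simp add: power2_eq_square)
next
  case False
  obtain s :: nat where s: "s\<^sup>2 \<le> A" "A < (Suc s)\<^sup>2" by (rule nat_sqrt_bounds)
  have s3: "3 \<le> s"
  proof (rule ccontr)
    assume "\<not> 3 \<le> s"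
    then have "(Suc s)\<^sup>2 \<le> 3\<^sup>2" by (intro power_mono) auto
    then show False using s False by simp
  qed
  have "3 * s \<le> s\<^sup>2" using s3 by (simp add: power2_eq_square)
  then have "Suc s < A" using s s3 by linarith
  moreover have "good_index A c" if "c < Suc s" for c
  proof (rule good_index_if_square_le)
    have "(c + 3)\<^sup>2 \<le> (2 * s)\<^sup>2" using that s3 by (intro power_mono) auto
    then show "(c + 3)\<^sup>2 \<le> 4 * A" using s by (simp add: power_mult_distrib)
  qed
  ultimately show ?thesis using that[of "Suc s"] s by simp
qed

text \<open>The variant for truncated gaps: the halved weight needs only half as many subgaps, so
  the integer square root itself suffices. The index is n + 1 because a truncated gap is part of a
  long one.\<close>

lemma some_good_indices:
  assumes "1 \<le> n"
  obtains g where "g \<le> n" "n + 1 \<le> (2 * g)\<^sup>2" "\<And>c. c < g \<Longrightarrow> good_index (n + 1) c"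
proof -
  obtain s :: nat where s: "s\<^sup>2 \<le> n" "n < (Suc s)\<^sup>2" by (rule nat_sqrt_bounds)
  have s1: "1 \<le> s" using s assms by (cases s) auto
  have "s \<le> s\<^sup>2" using s1 by (simp add: power2_eq_square)
  then have "s \<le> n" using s by linarith
  moreover have "(Suc s)\<^sup>2 \<le> (2 * s)\<^sup>2" using s1 by (intro power_mono) auto
  then have "n + 1 \<le> (2 * s)\<^sup>2" using s by linarith
  moreover have "good_index (n + 1) c" if "c < s" for c
  proof (cases "s = 1")
    case True
    then show ?thesis using that good_index_le_1 by simp
  next
    case False
    have "(c + 3)\<^sup>2 \<le> (2 * s)\<^sup>2" using that s1 False by (intro power_mono) auto
    then have "(c + 3)\<^sup>2 \<le> 4 * (n + 1)" using s by (simp add: power_mult_distrib)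
    then show ?thesis by (rule good_index_if_square_le)
  qed
  ultimately show ?thesis using that by blast
qed

lemma telescoped_lower_bound:
  fixes \<psi> :: "real \<Rightarrow> real"
  assumes "\<And>c. c < g \<Longrightarrow> v \<le> \<psi> ((real c + 1) * D) - \<psi> (real c * D)"
  shows "real g * v \<le> \<psi> (real g * D) - \<psi> 0"
  using assms
proof (induction g)
  case (Suc g)
  then have "real g * v \<le> \<psi> (real g * D) - \<psi> 0" "v \<le> \<psi> ((real g + 1) * D) - \<psi> (real g * D)"
    by auto
  then show ?case by (simp add: algebra_simps)
qed simp

text \<open>Contrapositive: if all admissible children are heavy, so is the gap. The three disjuncts
  are a short subgap, the whole last subgap, and its truncation. With A = 1 the last subgap is
  everything; A = 2 is subadditivity of the root; A = 3 needs two short subgaps; A = 4 and A = 5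
  also need the truncated one; from 6 on short subgaps suffice.\<close>

lemma full_node_light_part:
  fixes \<psi> :: "real \<Rightarrow> real"
  assumes \<psi>: "mono \<psi>" and D: "0 < E" "E < D" and A: "1 \<le> A"
    and light: "\<psi> (real A * D + E) - \<psi> 0 < sqrt (real A * D + E)"
  shows "(\<exists>c. c + 2 \<le> A \<and> good_index A c \<and> \<psi> ((real c + 1) * D) - \<psi> (real c * D) < sqrt D)
    \<or> (A \<le> 2 \<and> \<psi> (real A * D + E) - \<psi> (real A * D + E - (D + E)) < sqrt (D + E))
    \<or> \<psi> (real A * D + E) - \<psi> (real A * D + E - D) < sqrt D / 2"
proof (rule ccontr)
  assume "\<not> ?thesis"
  then have short: "\<And>c. c + 2 \<le> A \<Longrightarrow> good_index A c \<Longrightarrow> sqrt D \<le> \<psi> ((real c + 1) * D) - \<psi> (real c * D)"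
    and long: "A \<le> 2 \<Longrightarrow> sqrt (D + E) \<le> \<psi> (real A * D + E) - \<psi> (real A * D + E - (D + E))"
    and trunc: "sqrt D / 2 \<le> \<psi> (real A * D + E) - \<psi> (real A * D + E - D)"
    by (auto simp: not_less)
  have *: "real g * sqrt D \<le> \<psi> (real g * D) - \<psi> 0" if "g < A" "\<And>c. c < g \<Longrightarrow> good_index A c" for g
    using that by (intro telescoped_lower_bound short) auto
  have le: "\<psi> x \<le> \<psi> y" if "x \<le> y" for x y using \<psi> that by (rule monoD)
  have sq: "sqrt (real A * D + E) \<le> r * sqrt D" if "real A + 1 \<le> r\<^sup>2" "0 \<le> r" for r
  proof -
    have "(real A + 1) * D \<le> r\<^sup>2 * D" using that D by (intro mult_right_mono) auto
    then have "sqrt (real A * D + E) \<le> sqrt (r\<^sup>2 * D)" using D by (simp add: algebra_simps)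
    then show ?thesis using that by (simp add: real_sqrt_mult)
  qed
  consider "A = 1" | "A = 2" | "A = 3" | "A = 4 \<or> A = 5" | "6 \<le> A" using A by linarith
  then show False
  proof cases
    case 1
    then show False using long light by simp
  next
    case 2
    have "sqrt (real A * D + E) \<le> sqrt D + sqrt (D + E)"
      using sqrt_add_le_add_sqrt[of D "D + E"] D 2 by (simp add: algebra_simps)
    moreover have "sqrt D \<le> \<psi> D - \<psi> 0" using *[of 1] good_index_le_1 2 by simp
    moreover have "real A * D + E - (D + E) = D" using 2 by simp
    ultimately show False using long light 2 by simp
  next
    case 3
    have "2 * sqrt D \<le> \<psi> (2 * D) - \<psi> 0" using *[of 2] good_index_le_1 3 by simp
    also have "\<dots> \<le> \<psi> (real A * D + E) - \<psi> 0" using D 3 by (intro diff_right_mono le) simp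
    finally show False using light sq[of 2] 3 by simp
  next
    case 4
    have "2 * sqrt D \<le> \<psi> (2 * D) - \<psi> 0" using *[of 2] good_index_le_1 4 by auto
    moreover have "\<psi> (2 * D) \<le> \<psi> (real A * D + E - D)"
      using D 4 by (intro le) auto
    \<comment> \<open>Two short subgaps and half a root from the truncation give 5/2, whose square
      25/4 still exceeds A + 1 \<le> 6.\<close>
    ultimately show False using light trunc sq[of "5/2"] 4 by (auto simp: power2_eq_square)
  next
    case 5
    then obtain g where g: "g < A" "A + 1 \<le> g\<^sup>2" "\<And>c. c < g \<Longrightarrow> good_index A c"
      using many_good_indices by blast
    have "real g * sqrt D \<le> \<psi> (real g * D) - \<psi> 0" using * g by blast
    also have "\<dots> \<le> \<psi> (real A * D + E) - \<psi> 0"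
    proof -
      have "real g * D \<le> real A * D" using g D by (intro mult_right_mono) auto
      then have "real g * D \<le> real A * D + E" using D by linarith
      then show ?thesis by (intro diff_right_mono le)
    qed
    also have "\<dots> < real g * sqrt D"
    proof -
      have "real (A + 1) \<le> real (g\<^sup>2)" using g(2) by (simp only: of_nat_le_iff)
      then have "real A + 1 \<le> (real g)\<^sup>2" by simp
      then show ?thesis using light sq[of "real g"] by simp
    qed
    finally show False by simp
  qed
qed

text \<open>All short subgaps of the long gap fit into its truncation, and thanks to the halved
  weight the good ones among them suffice.\<close>

lemma truncated_node_light_part:
  fixes \<psi> :: "real \<Rightarrow> real"
  assumes \<psi>: "mono \<psi>" and D: "0 < E" "E < D" and n: "1 \<le> n"
    and light: "\<psi> (real n * D + E) - \<psi> 0 < sqrt (real n * D + E) / 2"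
  shows "\<exists>c<n. good_index (n + 1) c \<and> \<psi> ((real c + 1) * D) - \<psi> (real c * D) < sqrt D"
proof (rule ccontr)
  assume neg: "\<not> ?thesis"
  obtain g where g: "g \<le> n" "n + 1 \<le> (2 * g)\<^sup>2" "\<And>c. c < g \<Longrightarrow> good_index (n + 1) c"
    using some_good_indices n by blast
  have "real g * sqrt D \<le> \<psi> (real g * D) - \<psi> 0"
    using neg g by (intro telescoped_lower_bound) (force simp: not_less)
  also have "\<dots> \<le> \<psi> (real n * D + E) - \<psi> 0"
  proof -
    have "real g * D \<le> real n * D" using g D by (intro mult_right_mono) auto
    then have "real g * D \<le> real n * D + E" using D by linarith
    then show ?thesis using \<psi> by (intro diff_right_mono monoD[of \<psi>])
  qed
  also have "\<dots> < sqrt (real n * D + E) / 2" by (rule light)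
  also have "\<dots> \<le> (2 * real g) * sqrt D / 2"
  proof -
    have "real (n + 1) \<le> real ((2 * g)\<^sup>2)" using g(2) by (simp only: of_nat_le_iff)
    then have "real n + 1 \<le> (2 * real g)\<^sup>2" by simp
    then have "(real n + 1) * D \<le> (2 * real g)\<^sup>2 * D" using D by (intro mult_right_mono) auto
    then have "sqrt (real n * D + E) \<le> sqrt ((2 * real g)\<^sup>2 * D)" using D by (simp add: algebra_simps)
    then show ?thesis by (simp add: real_sqrt_mult)
  qed
  finally show False by simp
qed

section \<open>The tree of gaps and its light branches\<close>

text \<open>
A node \<open>(P, m, t)\<close> of level \<open>k\<close> is the gap starting at the orbit point \<open>P\<close> of index \<open>m\<close> in direction
\<open>(-1)^k\<close>; \<open>t\<close> marks a long gap (\<open>m \<le> q k\<close>) truncated to length \<open>d k\<close>. Directions alternate, so a child starts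
at the end of its subgap that is farther from \<open>P\<close>.
\<close>

type_synonym node = "real \<times> nat \<times> bool"

context irrational_rotation
begin

fun node_length :: "nat \<Rightarrow> node \<Rightarrow> real" where
  "node_length k (P, m, t) = (if t then d k else gap k m)"

fun node_weight :: "nat \<Rightarrow> node \<Rightarrow> real" where
  "node_weight k (P, m, t) = (if t then sqrt (d k) / 2 else sqrt (gap k m))"

fun valid_node :: "nat \<Rightarrow> node \<Rightarrow> bool" where
  "valid_node k (P, m, t) \<longleftrightarrow>
     1 \<le> m \<and> m \<le> q (Suc k) \<and> orbit_point m P \<and> (t \<longrightarrow> m \<le> q k)"

definition segment :: "nat \<Rightarrow> node \<Rightarrow> real set" where
  "segment k n = (\<lambda>x. fst n + (-1)^k * x) ` {0..node_length k n}"

text \<open>The sign makes this the increase from the left to the right endpoint, whichever way the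
  node points.\<close>

definition increment :: "(real \<Rightarrow> real) \<Rightarrow> nat \<Rightarrow> node \<Rightarrow> real" where
  "increment \<Phi> k n = (-1)^k * (\<Phi> (fst n + (-1)^k * node_length k n) - \<Phi> (fst n))"

definition light_child :: "(real \<Rightarrow> real) \<Rightarrow> nat \<Rightarrow> node \<Rightarrow> node \<Rightarrow> bool" where
  "light_child \<Phi> k n n' \<longleftrightarrow> valid_node (Suc k) n' \<and>
     increment \<Phi> (Suc k) n' < node_weight (Suc k) n' \<and>
     segment (Suc k) n' \<subseteq> segment k n \<and> (\<forall>y\<in>segment (Suc k) n'. reached k y)"

text \<open>Positions are measured from P in the direction of the parent. The child points the other
  way, so it starts at e and runs back to e - l.\<close>

lemma light_childI:
  fixes P :: real and \<Phi> :: "real \<Rightarrow> real" and k :: nat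
  defines "\<psi> \<equiv> \<lambda>x. (-1)^k * \<Phi> (P + (-1)^k * x)"
  assumes valid: "valid_node (Suc k) (P + (-1)^k * e, m', t')"
    and l: "l = node_length (Suc k) (P + (-1)^k * e, m', t')" "l \<le> e" "e \<le> node_length k (P, m, t)"
    and w: "\<psi> e - \<psi> (e - l) < node_weight (Suc k) (P + (-1)^k * e, m', t')"
    and r: "\<And>x. e - l \<le> x \<Longrightarrow> x \<le> e \<Longrightarrow> reached k (P + (-1)^k * x)"
  shows "\<exists>n'. light_child \<Phi> k (P, m, t) n'"
proof -
  let ?n = "(P + (-1)^k * e, m', t')"
  have seg: "segment (Suc k) ?n \<subseteq> (\<lambda>x. P + (-1)^k * x) ` {e - l..e}"
  proof
    fix y assume "y \<in> segment (Suc k) ?n"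
    then obtain x where x: "0 \<le> x" "x \<le> l" "y = P + (-1)^k * e + (-1)^Suc k * x"
      unfolding segment_def l(1) by auto
    then have "y = P + (-1)^k * (e - x)" by (simp add: algebra_simps)
    then show "y \<in> (\<lambda>x. P + (-1)^k * x) ` {e - l..e}" using x by auto
  qed
  also have "\<dots> \<subseteq> segment k (P, m, t)"
    unfolding segment_def fst_conv using l by (intro image_mono) auto
  finally have "segment (Suc k) ?n \<subseteq> segment k (P, m, t)" .
  moreover have "increment \<Phi> (Suc k) ?n = \<psi> e - \<psi> (e - l)"
    unfolding increment_def \<psi>_def l(1)[symmetric] by (simp add: algebra_simps)
  moreover have "\<forall>y\<in>segment (Suc k) ?n. reached k y" using seg r by fastforce
  ultimately show ?thesis using valid w unfolding light_child_def by (intro exI[of _ ?n]) simp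
qed

text \<open>The division point where the child starts has an index above \<open>q (Suc k)\<close>,
  so at the next level its gap is short, of length \<open>d (Suc k)\<close>: exactly the chosen
  subgap.\<close>

lemma short_light_child:
  fixes P :: real and \<Phi> :: "real \<Rightarrow> real" and k :: nat
  defines "\<psi> \<equiv> \<lambda>x. (-1)^k * \<Phi> (P + (-1)^k * x)"
  assumes valid: "valid_node k (P, m, t)" and c: "c + 2 \<le> fan k m" "good_index (fan k m) c"
    and len: "(real c + 1) * d (Suc k) \<le> node_length k (P, m, t)"
    and w: "\<psi> ((real c + 1) * d (Suc k)) - \<psi> (real c * d (Suc k)) < sqrt (d (Suc k))"
  shows "\<exists>n'. light_child \<Phi> k (P, m, t) n'"
proof -
  have P: "orbit_point m P" "1 \<le> m" "m \<le> q (Suc k)" using valid by auto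
  let ?m = "m + Suc c * q (Suc k)"
  have gt: "\<not> ?m \<le> q (Suc k)" using P by simp
  have g: "gap (Suc k) ?m = d (Suc k)" unfolding gap_eq by (simp only: gt if_False)
  show ?thesis
  proof (rule light_childI[where e = "(real c + 1) * d (Suc k)" and m' = ?m and t' = False
        and l = "d (Suc k)"])
    have "orbit_point ?m (P + (-1)^k * (real (Suc c) * d (Suc k)))"
      by (rule orbit_point_inner[OF P(1)])
    moreover have "?m \<le> q (Suc (Suc k))" using c by (intro inner_index_le[OF P(3)]) simp
    ultimately show "valid_node (Suc k) (P + (-1)^k * ((real c + 1) * d (Suc k)), ?m, False)"
      using P by (simp add: add.commute)
    show "d (Suc k) \<le> (real c + 1) * d (Suc k)" by (simp add: algebra_simps less_imp_le)
  next
    fix x assume "(real c + 1) * d (Suc k) - d (Suc k) \<le> x" "x \<le> (real c + 1) * d (Suc k)"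
    then show "reached k (P + (-1)^k * x)"
      using P c by (intro reached_short) (auto simp: algebra_simps)
  qed (use g len w in \<open>simp_all add: \<psi>_def algebra_simps\<close>)
qed

lemma light_child_exists:
  assumes \<Phi>: "mono \<Phi>" and valid: "valid_node k n" and light: "increment \<Phi> k n < node_weight k n"
  shows "\<exists>n'. light_child \<Phi> k n n'"
proof -
  obtain P m t where n: "n = (P, m, t)" by (cases n)
  have P: "orbit_point m P" "1 \<le> m" "m \<le> q (Suc k)" using valid n by auto
  define \<psi> where "\<psi> = (\<lambda>x. (-1)^k * \<Phi> (P + (-1)^k * x))"
  have mono: "mono \<psi>"
  proof (rule monoI)
    fix x y :: real assume "x \<le> y"
    then show "\<psi> x \<le> \<psi> y" unfolding \<psi>_def using monoD[OF \<Phi>] by (cases "even k") auto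
  qed
  have D: "0 < d (Suc (Suc k))" "d (Suc (Suc k)) < d (Suc k)" by (simp_all add: d_Suc_less)
  have incr: "increment \<Phi> k n = \<psi> (node_length k n) - \<psi> 0"
    unfolding increment_def \<psi>_def n by (simp add: algebra_simps)
  show ?thesis
  proof (cases t)
    case True
    then have mq: "m \<le> q k" using valid n by simp
    have "\<psi> (real (a k) * d (Suc k) + d (Suc (Suc k))) - \<psi> 0 < sqrt (real (a k) * d (Suc k) + d (Suc (Suc k))) / 2"
      using light True unfolding d_rec[symmetric] incr by (simp add: n)
    from truncated_node_light_part[OF mono D quot_pos this]
    obtain c where c: "c < a k" "good_index (a k + 1) c"
      "\<psi> ((real c + 1) * d (Suc k)) - \<psi> (real c * d (Suc k)) < sqrt (d (Suc k))" by blast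
    have "(real c + 1) * d (Suc k) \<le> real (a k) * d (Suc k)"
      using c by (intro mult_right_mono) (auto simp: less_imp_le)
    then have "(real c + 1) * d (Suc k) \<le> d k" using d_rec[of k] D by linarith
    then show ?thesis unfolding n using valid c mq True
      by (intro short_light_child[where c = c]) (auto simp: n fan_def \<psi>_def)
  next
    case False
    have g: "gap k m = real (fan k m) * d (Suc k) + d (Suc (Suc k))" by (rule gap_def)
    obtain m' where m': "1 \<le> m'" "m' \<le> q (Suc k)" "orbit_point m' (P + (-1)^k * gap k m)"
      using orbit_point_far_end P by blast
    have m'2: "m' \<le> q (Suc (Suc k))" using m' den_le_Suc[of "Suc k"] by linarith
    have A1: "d (Suc k) \<le> real (fan k m) * d (Suc k)" using fan_pos[of k m] D by simp
    have "\<psi> (gap k m) - \<psi> 0 < sqrt (gap k m)"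
      using light False unfolding incr by (simp add: n)
    then consider c where "c + 2 \<le> fan k m" "good_index (fan k m) c"
        "\<psi> ((real c + 1) * d (Suc k)) - \<psi> (real c * d (Suc k)) < sqrt (d (Suc k))"
      | "fan k m \<le> 2" "\<psi> (gap k m) - \<psi> (gap k m - (d (Suc k) + d (Suc (Suc k)))) < sqrt (d (Suc k) + d (Suc (Suc k)))"
      | "\<psi> (gap k m) - \<psi> (gap k m - d (Suc k)) < sqrt (d (Suc k)) / 2"
      using full_node_light_part[OF mono D fan_pos] unfolding g by blast
    then show ?thesis
    proof cases
      case (1 c)
      have "(real c + 1) * d (Suc k) \<le> real (fan k m) * d (Suc k)"
        using 1 by (intro mult_right_mono) (auto simp: less_imp_le)
      then have "(real c + 1) * d (Suc k) \<le> gap k m" unfolding g using D by linarith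
      then show ?thesis unfolding n using valid 1 False
        by (intro short_light_child[where c = c]) (auto simp: n \<psi>_def)
    next
      case 2
      \<comment> \<open>The far end has index at most \<open>q (Suc k)\<close>, so its gap at the
        next level is long and is exactly the last subgap.\<close>
      let ?l = "d (Suc k) + d (Suc (Suc k))"
      have g': "gap (Suc k) m' = ?l" unfolding gap_eq using m' by simp
      show ?thesis unfolding n
      proof (rule light_childI[where e = "gap k m" and m' = m' and t' = False and l = ?l])
        show "?l \<le> gap k m" unfolding g using A1 by linarith
        show "reached k (P + (-1)^k * x)" if "gap k m - ?l \<le> x" "x \<le> gap k m" for x
          using P 2(1) that by (rule reached_long)
        show "(-1)^k * \<Phi> (P + (-1)^k * gap k m) - (-1)^k * \<Phi> (P + (-1)^k * (gap k m - ?l))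
            < node_weight (Suc k) (P + (-1)^k * gap k m, m', False)"
          using 2(2) g' unfolding \<psi>_def by simp
      qed (use m' m'2 g' False in simp_all)
    next
      case 3
      show ?thesis unfolding n
      proof (rule light_childI[where e = "gap k m" and m' = m' and t' = True and l = "d (Suc k)"])
        show "d (Suc k) \<le> gap k m" unfolding g using A1 D by linarith
        show "reached k (P + (-1)^k * x)" if "gap k m - d (Suc k) \<le> x" "x \<le> gap k m" for x
          using P that by (rule reached_truncated)
        show "(-1)^k * \<Phi> (P + (-1)^k * gap k m) - (-1)^k * \<Phi> (P + (-1)^k * (gap k m - d (Suc k)))
            < node_weight (Suc k) (P + (-1)^k * gap k m, m', True)"
          using 3 unfolding \<psi>_def by simp
      qed (use m' m'2 False in simp_all)
    qed
  qed
qed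

section \<open>Sizes of nodes and the infinite descent past a cover\<close>

lemma node_length_bounds:
  "d k \<le> node_length k n" "node_length k n \<le> 2 * d k"
  using d_Suc_less[of k] less_imp_le[OF d_pos[of k]] less_imp_le[OF d_pos[of "Suc k"]]
  by (cases n; simp add: gap_eq)+

text \<open>The right-hand side is the rise of a line of slope \<open>1 / sqrt (d k)\<close> over
  the node; a node lying under such a line cannot be light.\<close>

lemma node_weight_le: "node_weight k n \<le> node_length k n / sqrt (d k)"
proof -
  obtain P m t where n: "n = (P, m, t)" by (cases n)
  show ?thesis
  proof (cases t)
    case True
    then show ?thesis using less_imp_le[OF d_pos[of k]] by (simp add: n real_div_sqrt)
  next
    case False
    have le: "d k \<le> gap k m" using node_length_bounds(1)[of k n] False n by simp
    have g: "0 \<le> gap k m" using le d_pos[of k] by linarith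
    have "sqrt (gap k m) * sqrt (d k) \<le> sqrt (gap k m) * sqrt (gap k m)"
      using le g by (intro mult_left_mono) auto
    then show ?thesis using False g by (simp add: n field_simps)
  qed
qed

lemma node_weight_pos: "0 < node_weight k n"
proof -
  obtain P m t where n: "n = (P, m, t)" by (cases n)
  have "0 < gap k m" using d_pos[of k] d_pos[of "Suc k"] unfolding gap_eq by (simp add: add_pos_pos)
  then show ?thesis by (simp add: n)
qed

lemma node_endpoints:
  obtains lo hi where "segment k n = {lo..hi}" "hi - lo = node_length k n"
    "\<And>\<Phi>. increment \<Phi> k n = \<Phi> hi - \<Phi> lo"
proof (cases "even k")
  case True
  then show ?thesis using that[of "fst n" "fst n + node_length k n"]
    unfolding segment_def increment_def by simp
next
  case False
  have "(\<lambda>x. fst n - x) ` {0..node_length k n} = {fst n - node_length k n..fst n}" by simp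
  then show ?thesis using False that[of "fst n - node_length k n" "fst n"]
    unfolding segment_def increment_def by simp
qed

text \<open>Dependent choice of light children, then compactness of the nested segments. Passing
  from \<Phi> j to \<Phi> (Suc j) only lowers increments, so a child stays light.\<close>

lemma light_path:
  assumes mono: "\<And>j. mono (\<Phi> j)"
    and dec: "\<And>j x y. x \<le> y \<Longrightarrow> \<Phi> (Suc j) y - \<Phi> (Suc j) x \<le> \<Phi> j y - \<Phi> j x"
    and root: "valid_node K n0" "increment (\<Phi> K) K n0 < node_weight K n0"
  obtains N y where "y \<in> segment K n0"
    "\<And>j. K \<le> j \<Longrightarrow> increment (\<Phi> j) j (N j) < node_weight j (N j) \<and> y \<in> segment j (N j)"
    "\<And>j. K \<le> j \<Longrightarrow> reached j y"
proof -
  have "\<exists>f. \<forall>i. (valid_node (K + i) (f i) \<and> increment (\<Phi> (K + i)) (K + i) (f i) < node_weight (K + i) (f i)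
       \<and> (i = 0 \<longrightarrow> f i = n0)) \<and>
     (segment (K + Suc i) (f (Suc i)) \<subseteq> segment (K + i) (f i) \<and> (\<forall>y\<in>segment (K + Suc i) (f (Suc i)). reached (K + i) y))"
  proof (rule dependent_nat_choice)
    show "\<exists>n. valid_node (K + 0) n \<and> increment (\<Phi> (K + 0)) (K + 0) n < node_weight (K + 0) n \<and> (0 = (0::nat) \<longrightarrow> n = n0)"
      using root by (intro exI[of _ n0]) simp
  next
    fix n i
    assume n: "valid_node (K + i) n \<and> increment (\<Phi> (K + i)) (K + i) n < node_weight (K + i) n \<and> (i = 0 \<longrightarrow> n = n0)"
    then obtain n' where n': "light_child (\<Phi> (K + i)) (K + i) n n'"
      using light_child_exists[OF mono] by blast
    have "increment (\<Phi> (Suc (K + i))) (Suc (K + i)) n' \<le> increment (\<Phi> (K + i)) (Suc (K + i)) n'"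
    proof -
      obtain lo hi where e: "hi - lo = node_length (Suc (K + i)) n'"
        "\<And>\<Phi>. increment \<Phi> (Suc (K + i)) n' = \<Phi> hi - \<Phi> lo"
        using node_endpoints by metis
      have "lo \<le> hi" using e(1) node_length_bounds(1)[of "Suc (K + i)" n'] d_pos[of "Suc (K + i)"] by linarith
      then show ?thesis unfolding e(2) by (rule dec)
    qed
    then show "\<exists>n'. (valid_node (K + Suc i) n' \<and> increment (\<Phi> (K + Suc i)) (K + Suc i) n' < node_weight (K + Suc i) n'
          \<and> (Suc i = 0 \<longrightarrow> n' = n0)) \<and>
        segment (K + Suc i) n' \<subseteq> segment (K + i) n \<and> (\<forall>y\<in>segment (K + Suc i) n'. reached (K + i) y)"
      using n' unfolding light_child_def by (intro exI[of _ n']) auto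
  qed
  then obtain f where f: "\<And>i. increment (\<Phi> (K + i)) (K + i) (f i) < node_weight (K + i) (f i)" "f 0 = n0"
    "\<And>i. segment (K + Suc i) (f (Suc i)) \<subseteq> segment (K + i) (f i)"
    "\<And>i y. y \<in> segment (K + Suc i) (f (Suc i)) \<Longrightarrow> reached (K + i) y"
    by blast
  have "\<Inter> (range (\<lambda>i. segment (K + i) (f i))) \<noteq> {}"
  proof (rule compact_nest)
    fix i
    obtain lo hi where e: "segment (K + i) (f i) = {lo..hi}" "hi - lo = node_length (K + i) (f i)"
      using node_endpoints by metis
    show "compact (segment (K + i) (f i))" unfolding e by simp
    have "lo \<le> hi" using e(2) node_length_bounds(1)[of "K + i" "f i"] d_pos[of "K + i"] by linarith
    then show "segment (K + i) (f i) \<noteq> {}" unfolding e by simp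
  next
    fix m n :: nat assume "m \<le> n"
    then show "segment (K + n) (f n) \<subseteq> segment (K + m) (f m)"
      by (rule lift_Suc_antimono_le[of "\<lambda>i. segment (K + i) (f i)", OF f(3)])
  qed
  then obtain y where y: "\<And>i. y \<in> segment (K + i) (f i)" by blast
  show ?thesis
  proof (rule that[of y "\<lambda>j. f (j - K)"])
    show "y \<in> segment K n0" using y[of 0] f(2) by simp
    fix j assume j: "K \<le> j"
    show "increment (\<Phi> j) j (f (j - K)) < node_weight j (f (j - K)) \<and> y \<in> segment j (f (j - K))"
      using f(1)[of "j - K"] y[of "j - K"] j by simp
    show "reached j y" using f(4)[OF y, of "j - K"] j by simp
  qed
qed

lemma uncovered_reached_point:
  fixes \<alpha> r :: "nat \<Rightarrow> real" and l :: "nat \<Rightarrow> nat"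
  defines "cost \<equiv> \<lambda>i. (r i + 4 * d (l i)) / sqrt (d (l i))"
  assumes C: "\<And>i. C i \<subseteq> {\<alpha> i..\<alpha> i + r i}" and r: "\<And>i. 0 \<le> r i" and l: "\<And>i. K \<le> l i"
    and summable: "summable cost" and sum: "suminf cost < node_weight K n0" and root: "valid_node K n0"
  obtains y where "y \<in> segment K n0" "\<And>j. K \<le> j \<Longrightarrow> reached j y" "\<And>i. y \<notin> C i"
proof -
  \<comment> \<open>The ramp extends beyond the interval around \<open>C i\<close> by 2
    \<open>d (l i)\<close> on each side, the maximal length of a node of level
    \<open>l i\<close>.\<close>
  define \<phi> where "\<phi> = (\<lambda>i x. max 0 (min (r i + 4 * d (l i)) (x - (\<alpha> i - 2 * d (l i)))) / sqrt (d (l i)))"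
  \<comment> \<open>Sets whose level has been passed are dropped: they were already avoided.\<close>
  define \<Phi> where "\<Phi> = (\<lambda>j x. \<Sum>i. if j \<le> l i then \<phi> i x else 0)"
  have \<phi>_nonneg: "0 \<le> \<phi> i x" for i x unfolding \<phi>_def by (simp add: less_imp_le)
  have \<phi>_le: "\<phi> i x \<le> cost i" for i x
    unfolding \<phi>_def cost_def using r[of i] less_imp_le[OF d_pos[of "l i"]] by (intro divide_right_mono) auto
  have \<phi>_mono: "\<phi> i x \<le> \<phi> i y" if "x \<le> y" for i x y
    unfolding \<phi>_def using that by (intro divide_right_mono) (auto simp: less_imp_le)
  have sm: "summable (\<lambda>i. if j \<le> l i then \<phi> i x else 0)" for j x
  proof (rule summable_comparison_test'[OF summable, of 0])
    fix i
    show "norm (if j \<le> l i then \<phi> i x else 0) \<le> cost i"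
      using \<phi>_nonneg[of i x] \<phi>_le[of i x] by simp
  qed
  have diff: "\<Phi> j y - \<Phi> j x = (\<Sum>i. if j \<le> l i then \<phi> i y - \<phi> i x else 0)"
    and smd: "summable (\<lambda>i. if j \<le> l i then \<phi> i y - \<phi> i x else 0)" for j x y
  proof -
    have e: "(\<lambda>i. if j \<le> l i then \<phi> i y - \<phi> i x else 0)
        = (\<lambda>i. (if j \<le> l i then \<phi> i y else 0) - (if j \<le> l i then \<phi> i x else 0))" by auto
    show "\<Phi> j y - \<Phi> j x = (\<Sum>i. if j \<le> l i then \<phi> i y - \<phi> i x else 0)"
      unfolding \<Phi>_def e by (rule suminf_diff[OF sm sm])
    show "summable (\<lambda>i. if j \<le> l i then \<phi> i y - \<phi> i x else 0)"
      unfolding e by (rule summable_diff[OF sm sm])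
  qed
  have mono: "mono (\<Phi> j)" for j
  proof (rule monoI)
    fix x y :: real assume "x \<le> y"
    then show "\<Phi> j x \<le> \<Phi> j y" unfolding \<Phi>_def using \<phi>_mono by (intro suminf_le sm) auto
  qed
  have dec: "\<Phi> (Suc j) y - \<Phi> (Suc j) x \<le> \<Phi> j y - \<Phi> j x" if "x \<le> y" for j x y
    unfolding diff using \<phi>_mono[OF that] by (intro suminf_le smd) auto
  have "increment (\<Phi> K) K n0 < node_weight K n0"
  proof -
    obtain lo hi where e: "\<And>\<Phi>. increment \<Phi> K n0 = \<Phi> hi - \<Phi> lo"
      using node_endpoints by metis
    have "increment (\<Phi> K) K n0 \<le> suminf cost"
      unfolding e diff using l
    proof (intro suminf_le smd summable)
      fix i
      show "(if K \<le> l i then \<phi> i hi - \<phi> i lo else 0) \<le> cost i"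
        using \<phi>_le[of i hi] \<phi>_nonneg[of i lo] l[of i] by simp
    qed
    then show ?thesis using sum by linarith
  qed
  from light_path[where \<Phi> = \<Phi>, OF mono dec root this]
  obtain N y where y: "y \<in> segment K n0"
    "\<And>j. K \<le> j \<Longrightarrow> increment (\<Phi> j) j (N j) < node_weight j (N j) \<and> y \<in> segment j (N j)"
    "\<And>j. K \<le> j \<Longrightarrow> reached j y" by metis
  have "y \<notin> C i" for i
  proof
    assume yC: "y \<in> C i"
    let ?k = "l i"
    obtain lo hi where e: "segment ?k (N ?k) = {lo..hi}" "hi - lo = node_length ?k (N ?k)"
      "\<And>\<Phi>. increment \<Phi> ?k (N ?k) = \<Phi> hi - \<Phi> lo"
      using node_endpoints by metis
    have light: "\<Phi> ?k hi - \<Phi> ?k lo < node_weight ?k (N ?k)" and ys: "lo \<le> y" "y \<le> hi"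
      using y(2)[OF l[of i]] e by auto
    have len: "hi - lo \<le> 2 * d ?k" using e(2) node_length_bounds by simp
    have y\<alpha>: "\<alpha> i \<le> y" "y \<le> \<alpha> i + r i" using yC C[of i] by auto
    \<comment> \<open>A node of this level that meets \<open>C i\<close> lies where the ramp is not
      clamped, so it rises by the full length over \<open>sqrt (d (l i))\<close>.\<close>
    have "\<phi> i hi = (hi - (\<alpha> i - 2 * d ?k)) / sqrt (d ?k)" "\<phi> i lo = (lo - (\<alpha> i - 2 * d ?k)) / sqrt (d ?k)"
      unfolding \<phi>_def using len ys y\<alpha> by (simp_all add: max_def min_def)
    then have "node_length ?k (N ?k) / sqrt (d ?k) = \<phi> i hi - \<phi> i lo"
      unfolding e(2)[symmetric] by (simp add: diff_divide_distrib)
    also have "\<dots> = (\<Sum>i'\<in>{i}. if ?k \<le> l i' then \<phi> i' hi - \<phi> i' lo else 0)" by simp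
    also have "\<dots> \<le> \<Phi> ?k hi - \<Phi> ?k lo"
      unfolding diff using \<phi>_mono[of lo hi] ys by (intro sum_le_suminf smd) auto
    finally show False using light node_weight_le[of ?k "N ?k"] by linarith
  qed
  then show ?thesis using y that by blast
qed

section \<open>Membership in \<open>U1\<close> and the cost of a single cover set\<close>

lemma U1_if_reached:
  assumes "0 \<le> y" "y < 1" "\<And>j. K \<le> j \<Longrightarrow> reached j y"
  shows "y \<in> U1 \<theta>"
proof -
  have "\<exists>n::nat. 1 \<le> n \<and> real n \<le> Q \<and> dnint (real n * \<theta> - y) < 1 / Q"
    if Q: "real (q (Suc K)) \<le> Q" for Q
  proof -
    obtain c :: nat where c: "Q < real c" using reals_Archimedean2 by blast
    have "c \<le> q (Suc K + c)" using den_ge[of "K + c"] by simp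
    then have "Q < real (q (Suc K + c))" using c by linarith
    then obtain b where "real (q (Suc K + b)) \<le> Q" "Q < real (q (Suc K + Suc b))"
      using interval_step_exists[of "\<lambda>b. real (q (Suc K + b))" Q c] Q by auto
    then show ?thesis using assms(3)[of "K + b"] unfolding reached_def by simp
  qed
  then show ?thesis using assms unfolding U1_def by auto
qed

text \<open>With consecutive errors z \<le> r < x, the level of x costs at most 5 sqrt x and the
  level of z at most 5 r / sqrt z. The cheaper choice is made; the two agree at r = sqrt (x z),
  where the growth hypothesis turns either into \<open>r powr s\<close>.\<close>

lemma level_for_diameter:
  assumes c: "0 < c" and w: "0 < w" and gr: "\<And>k. K \<le> k \<Longrightarrow> c * d k powr w \<le> d (Suc k)"
    and r: "0 < r" "r < d K"
  defines "s \<equiv> 1 / (1 + w)"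
  obtains k where "K \<le> k" "(r + 4 * d k) / sqrt (d k) \<le> 5 * c powr (- s / 2) * r powr s"
proof -
  have s: "0 < s" "s < 1" "1 - s = w * s" unfolding s_def using w by (auto simp: field_simps)
  have "\<exists>n. d (K + n) \<le> r"
  proof -
    have "\<forall>\<^sub>F k in sequentially. d k < r" by (rule order_tendstoD(2)[OF d_tendsto_0 r(1)])
    then obtain n0 where "\<And>k. n0 \<le> k \<Longrightarrow> d k < r" unfolding eventually_sequentially by blast
    then show ?thesis by (intro exI[of _ n0]) (simp add: less_imp_le)
  qed
  then obtain n where n: "d (K + n) \<le> r" "\<And>m. m < n \<Longrightarrow> \<not> d (K + m) \<le> r"
    using exists_least_iff[of "\<lambda>n. d (K + n) \<le> r"] by blast
  have "n \<noteq> 0" using n(1) r by (cases n) auto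
  then obtain m where m: "n = Suc m" by (cases n) auto
  define x where "x = d (K + m)"
  define z where "z = d (Suc (K + m))"
  have pos: "0 < x" "0 < z" unfolding x_def z_def by simp_all
  have zr: "z \<le> r" "r < x" using n m unfolding x_def z_def by (auto simp: not_le)
  have zc: "c * x powr w \<le> z" unfolding x_def z_def by (rule gr) simp
  \<comment> \<open>The growth hypothesis raised to the power s / 2. As w s + s = 1, it replaces
    part of a power of x by a power of z.\<close>
  have h: "x powr (w * s / 2) \<le> c powr (- s / 2) * z powr (s / 2)"
  proof -
    have "c powr (s / 2) * x powr (w * s / 2) = (c * x powr w) powr (s / 2)"
      using c pos by (simp add: powr_mult powr_powr)
    also have "\<dots> \<le> z powr (s / 2)" using zc c pos s by (intro powr_mono2) auto
    finally have "c powr (- s / 2) * (c powr (s / 2) * x powr (w * s / 2)) \<le> c powr (- s / 2) * z powr (s / 2)"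
      by (intro mult_left_mono) auto
    moreover have "c powr (- s / 2) * c powr (s / 2) = 1" using c by (simp add: powr_add[symmetric])
    ultimately show ?thesis by (simp add: mult.assoc[symmetric])
  qed
  show ?thesis
  proof (cases "sqrt (x * z) \<le> r")
    case True
    have "sqrt x = x powr (w * s / 2) * x powr (s / 2)"
    proof -
      have "w * s / 2 + s / 2 = 1 / 2" using s(3) by (simp add: field_simps)
      then show ?thesis using pos by (simp only: powr_add[symmetric] powr_half_sqrt less_imp_le)
    qed
    also have "\<dots> \<le> (c powr (- s / 2) * z powr (s / 2)) * x powr (s / 2)"
      using h by (intro mult_right_mono) auto
    also have "\<dots> = c powr (- s / 2) * (x * z) powr (s / 2)" using pos by (simp add: powr_mult)
    also have "(x * z) powr (s / 2) = sqrt (x * z) powr s"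
      using pos by (simp add: powr_half_sqrt[symmetric] powr_powr)
    also have "c powr (- s / 2) * sqrt (x * z) powr s \<le> c powr (- s / 2) * r powr s"
      using True s pos by (intro mult_left_mono powr_mono2) auto
    finally have "sqrt x \<le> c powr (- s / 2) * r powr s" .
    moreover have "(r + 4 * x) / sqrt x \<le> 5 * sqrt x"
    proof -
      have "(r + 4 * x) / sqrt x \<le> (5 * x) / sqrt x" using zr pos by (intro divide_right_mono) auto
      also have "\<dots> = 5 * sqrt x" using pos real_div_sqrt[of x] by simp
      finally show ?thesis .
    qed
    ultimately show ?thesis by (intro that[of "K + m"]) (simp_all add: x_def)
  next
    case False
    have "r powr (1 - s) \<le> sqrt (x * z) powr (1 - s)"
      using False s r by (intro powr_mono2) auto
    also have "\<dots> = (x * z) powr ((1 - s) / 2)"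
      using pos by (simp add: powr_half_sqrt[symmetric] powr_powr)
    also have "\<dots> = x powr (w * s / 2) * z powr ((1 - s) / 2)" using pos s by (simp add: powr_mult)
    also have "\<dots> \<le> (c powr (- s / 2) * z powr (s / 2)) * z powr ((1 - s) / 2)"
      using h by (intro mult_right_mono) auto
    also have "\<dots> = c powr (- s / 2) * sqrt z"
    proof -
      have "s / 2 + (1 - s) / 2 = 1 / 2" by (simp add: field_simps)
      then have "z powr (s / 2) * z powr ((1 - s) / 2) = sqrt z"
        using pos by (simp only: powr_add[symmetric] powr_half_sqrt less_imp_le)
      then show ?thesis by (simp only: mult.assoc)
    qed
    finally have "r powr s * r powr (1 - s) \<le> r powr s * (c powr (- s / 2) * sqrt z)"
      by (intro mult_left_mono) auto
    then have "r \<le> r powr s * (c powr (- s / 2) * sqrt z)"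
      using r by (simp add: powr_add[symmetric])
    then have rz: "r / sqrt z \<le> c powr (- s / 2) * r powr s"
      using pos by (simp add: pos_divide_le_eq algebra_simps)
    have "(r + 4 * z) / sqrt z \<le> (5 * r) / sqrt z" using zr pos by (intro divide_right_mono) auto
    then have "(r + 4 * z) / sqrt z \<le> 5 * (r / sqrt z)" by simp
    then show ?thesis using rz by (intro that[of "Suc (K + m)"]) (simp_all add: z_def)
  qed
qed

text \<open>A nonzero lower limit is positive, hence bounds j to the power w times the distance from
  below. At j = \<open>q (Suc k)\<close> that distance is at most \<open>d (Suc k)\<close>, and j is
  at most \<open>1 / d k\<close>.\<close>

lemma err_lower_bound:
  assumes w: "0 < w"
    and lim: "Liminf sequentially (\<lambda>j::nat. ereal (real j powr w * dnint (real j * \<theta>))) \<noteq> 0"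
  obtains c K where "0 < c" "\<And>k. K \<le> k \<Longrightarrow> c * d k powr w \<le> d (Suc k)"
proof -
  let ?f = "\<lambda>j::nat. ereal (real j powr w * dnint (real j * \<theta>))"
  have "0 \<le> Liminf sequentially ?f" by (intro Liminf_bounded always_eventually allI) (simp add: dnint_nonneg)
  then have "0 < Liminf sequentially ?f" using lim by simp
  then obtain c where c: "0 < ereal c" "ereal c < Liminf sequentially ?f" using ereal_dense2 by blast
  have "\<forall>\<^sub>F j in sequentially. ereal c < ?f j" by (rule less_LiminfD[OF c(2)])
  then obtain K where K: "\<And>j. K \<le> j \<Longrightarrow> c < real j powr w * dnint (real j * \<theta>)"
    unfolding eventually_sequentially by auto
  show ?thesis
  proof (rule that[of c K])
    show "0 < c" using c by simp
    fix k assume k: "K \<le> k"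
    let ?q = "real (q (Suc k))"
    have q0: "0 < ?q" using den_pos[of k] by simp
    have "dnint (?q * \<theta>) \<le> \<bar>?q * \<theta> - of_int (int (p (Suc k)))\<bar>" by (rule dnint_le)
    also have "\<dots> = d (Suc k)"
    proof -
      have "\<bar>?q * \<theta> - real (p (Suc k))\<bar> = \<bar>d (Suc k)\<bar>" unfolding den_err[of "Suc k"] by (simp add: abs_mult power_abs)
      then show ?thesis by (simp add: less_imp_le)
    qed
    finally have "?q powr w * dnint (?q * \<theta>) \<le> ?q powr w * d (Suc k)" by (intro mult_left_mono) auto
    then have cq: "c \<le> ?q powr w * d (Suc k)" using K[of "q (Suc k)"] k den_ge[of k] by linarith
    have "(?q * d k) powr w \<le> 1" using den_d_le[of k] w q0 by (intro powr_le1) (auto simp: less_imp_le)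
    then have qd: "?q powr w * d k powr w \<le> 1" using q0 by (simp add: powr_mult less_imp_le)
    have "c * d k powr w \<le> (?q powr w * d (Suc k)) * d k powr w" using cq by (intro mult_right_mono) auto
    also have "\<dots> = (?q powr w * d k powr w) * d (Suc k)" by (simp add: algebra_simps)
    also have "\<dots> \<le> 1 * d (Suc k)" using qd by (intro mult_right_mono) (auto simp: less_imp_le)
    finally show "c * d k powr w \<le> d (Suc k)" by simp
  qed
qed

end

section \<open>Hausdorff measure\<close>

lemma hausdorff_null_cover:
  assumes "hausdorff_measure s A = 0" "0 < e"
  obtains C :: "nat \<Rightarrow> real set" where "\<And>i. bounded (C i)" "A \<subseteq> (\<Union>i. C i)"
    "summable (\<lambda>i. diameter (C i) powr s)" "(\<Sum>i. diameter (C i) powr s) < e"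
proof -
  let ?S = "{(\<Sum>i. ennreal (diameter (C i) powr s)) | C :: nat \<Rightarrow> real set.
      (\<forall>i. bounded (C i) \<and> diameter (C i) \<le> 1) \<and> A \<subseteq> (\<Union>i. C i)}"
  have "hausdorff_content s 1 A \<le> hausdorff_measure s A"
    unfolding hausdorff_measure_def by (rule SUP_upper) simp
  then have "Inf ?S < ennreal e" using assms unfolding hausdorff_content_def by simp
  then obtain C :: "nat \<Rightarrow> real set" where C: "\<And>i. bounded (C i)" "A \<subseteq> (\<Union>i. C i)"
    and lt: "(\<Sum>i. ennreal (diameter (C i) powr s)) < ennreal e"
    unfolding Inf_less_iff by blast
  have fin: "(\<Sum>i. ennreal (diameter (C i) powr s)) \<noteq> top" using lt by auto
  have sm: "summable (\<lambda>i. diameter (C i) powr s)" by (rule summable_suminf_not_top[OF _ fin]) simp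
  have "ennreal (\<Sum>i. diameter (C i) powr s) < ennreal e" using lt by (subst suminf_ennreal2[symmetric]) (auto intro: sm)
  then have "(\<Sum>i. diameter (C i) powr s) < e" by (simp add: ennreal_less_iff suminf_nonneg[OF sm])
  then show ?thesis using that C sm by blast
qed

text \<open>N intervals of length 1 / N contribute 1 / N. This provides an element of the set whose
  real infimum is the dimension.\<close>

lemma hausdorff_measure_2_unit_interval:
  assumes A: "A \<subseteq> {0..<1::real}"
  shows "hausdorff_measure 2 A = 0"
proof -
  have "hausdorff_content 2 \<delta> A \<le> ennreal e" if \<delta>: "0 < \<delta>" and e: "0 < e" for \<delta> e :: real
  proof -
    obtain N :: nat where N: "0 < N" "1 / real N < min \<delta> e"
      using reals_Archimedean[of "min \<delta> e"] \<delta> e by (auto simp: inverse_eq_divide simp del: of_nat_Suc)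
    define C where "C = (\<lambda>i. if i < N then {real i / real N..real (Suc i) / real N} else {})"
    have dm: "diameter (C i) = (if i < N then 1 / real N else 0)" for i
    proof -
      have "real i / real N \<le> real (Suc i) / real N" by (intro divide_right_mono) auto
      then show ?thesis unfolding C_def by (auto simp: diff_divide_distrib[symmetric])
    qed
    have "A \<subseteq> (\<Union>i. C i)"
    proof
      fix x assume "x \<in> A"
      then have x: "0 \<le> x" "x < 1" using A by auto
      let ?i = "nat \<lfloor>x * real N\<rfloor>"
      have "x * real N < real N" using x N by simp
      moreover have "0 \<le> x * real N" using x by simp
      ultimately have "?i < N" "real ?i \<le> x * real N" "x * real N \<le> real (Suc ?i)" by linarith+
      then have "x \<in> C ?i" unfolding C_def using N by (simp add: field_simps)
      then show "x \<in> (\<Union>i. C i)" by blast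
    qed
    moreover have "bounded (C i) \<and> diameter (C i) \<le> \<delta>" for i
      using N \<delta> dm[of i] unfolding C_def by auto
    ultimately have "hausdorff_content 2 \<delta> A \<le> (\<Sum>i. ennreal (diameter (C i) powr 2))"
      unfolding hausdorff_content_def by (intro Inf_lower) blast
    also have "\<dots> = (\<Sum>i<N. ennreal (diameter (C i) powr 2))" by (rule suminf_finite) (auto simp: dm)
    also have "\<dots> = (\<Sum>i<N. ennreal ((1 / real N) powr 2))" by (rule sum.cong) (auto simp: dm)
    also have "\<dots> = ennreal (real N * (1 / real N) powr 2)" by (simp add: ennreal_mult' ennreal_of_nat_eq_real_of_nat)
    also have "real N * (1 / real N) powr 2 = 1 / real N" using N by (simp add: power2_eq_square)
    also have "ennreal (1 / real N) \<le> ennreal e" using N by (intro ennreal_leI) simp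
    finally show ?thesis .
  qed
  then have "hausdorff_content 2 \<delta> A = 0" if "0 < \<delta>" for \<delta>
    using that by (metis ennreal_le_epsilon add_0 le_zero_eq)
  then show ?thesis unfolding hausdorff_measure_def by (simp add: bot_ennreal[symmetric])
qed

section \<open>The lower bound for the dimension\<close>

context irrational_rotation
begin

lemma eventually_d_less:
  assumes "0 < e"
  obtains k where "k0 \<le> k" "d k < e"
proof -
  have "\<forall>\<^sub>F k in sequentially. d k < e" by (rule order_tendstoD(2)[OF d_tendsto_0 assms])
  then obtain n where "\<And>k. n \<le> k \<Longrightarrow> d k < e" unfolding eventually_sequentially by blast
  then show ?thesis using that[of "max k0 n"] by simp
qed

text \<open>Guarantees that the supremum is not over an empty set and is positive. Otherwise c sqrt
  (d k) \<le> \<open>d (Suc k)\<close> < \<open>d k\<close> would bound \<open>d k\<close> away from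
  0.\<close>

lemma irr_exp_ge_half: "ereal (1/2) \<le> irr_exp \<theta>"
proof -
  have "Liminf sequentially (\<lambda>j::nat. ereal (real j powr (1/2) * dnint (real j * \<theta>))) = 0"
  proof (rule ccontr)
    assume "\<not> ?thesis"
    then obtain c K where c: "0 < c" "\<And>k. K \<le> k \<Longrightarrow> c * d k powr (1/2) \<le> d (Suc k)"
      using err_lower_bound[of "1/2"] by auto
    obtain k where k: "K \<le> k" "d k < c\<^sup>2" using eventually_d_less[of "c\<^sup>2" K] c by auto
    have "c * sqrt (d k) < sqrt (d k) * sqrt (d k)"
      using c(2)[OF k(1)] d_Suc_less[of k] by (simp add: powr_half_sqrt less_imp_le)
    then have "c < sqrt (d k)" by (rule mult_right_less_imp_less) (simp add: less_imp_le)
    moreover have "sqrt (d k) < c" using k c by (intro real_less_lsqrt) (auto simp: less_imp_le)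
    ultimately show False by simp
  qed
  then show ?thesis unfolding irr_exp_def
    by (intro Sup_upper CollectI exI[of _ "1/2"]) simp
qed

lemma hausdorff_measure_U1_nonzero:
  assumes w: "0 < w" and c: "0 < c" "\<And>k. K0 \<le> k \<Longrightarrow> c * d k powr w \<le> d (Suc k)"
  shows "hausdorff_measure (1 / (1 + w)) (U1 \<theta>) \<noteq> 0"
proof
  define s where "s = 1 / (1 + w)"
  assume "hausdorff_measure (1 / (1 + w)) (U1 \<theta>) = 0"
  then have null: "hausdorff_measure s (U1 \<theta>) = 0" unfolding s_def .
  have s: "0 < s" unfolding s_def using w by simp
  \<comment> \<open>A node of level K has length at most 2 \<open>d K\<close>, so this keeps the
    starting gap at \<theta> inside the unit interval.\<close>
  have "0 < min \<theta> (1 - \<theta>) / 2" using theta_pos theta_less_1 by simp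
  then obtain K where K: "Suc K0 \<le> K" "d K < min \<theta> (1 - \<theta>) / 2" using eventually_d_less by blast
  define n0 :: node where "n0 = (\<theta>, 1, False)"
  have root: "valid_node K n0"
    using den_pos[of K] unfolding n0_def by (simp add: orbit_point_def)
  have seg: "segment K n0 \<subseteq> {0..<1}"
  proof
    fix y assume "y \<in> segment K n0"
    then obtain x where x: "0 \<le> x" "x \<le> node_length K n0" "y = \<theta> + (-1)^K * x"
      unfolding segment_def n0_def by auto
    have "\<bar>y - \<theta>\<bar> = x" using x by (simp add: abs_mult power_abs)
    moreover have "x \<le> 2 * d K" using x node_length_bounds(2)[of K n0] by linarith
    ultimately show "y \<in> {0..<1}" using K by auto
  qed
  define M where "M = 5 * c powr (- s / 2)"
  have M: "0 < M" unfolding M_def using c by simp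
  \<comment> \<open>The first bound makes every \<open>r i\<close> smaller than \<open>d K\<close>,
    as \<open>level_for_diameter\<close> requires; the second keeps the total cost below the weight
    of the starting gap.\<close>
  define e where "e = min (d K powr s) (node_weight K n0 / M) / 4"
  have e: "0 < e" unfolding e_def using M node_weight_pos[of K n0] less_imp_neq[OF d_pos[of K]] by simp
  have e_le: "4 * e \<le> d K powr s" "4 * e \<le> node_weight K n0 / M" unfolding e_def by simp_all
  obtain C where C: "\<And>i. bounded (C i)" "U1 \<theta> \<subseteq> (\<Union>i. C i)"
    "summable (\<lambda>i. diameter (C i) powr s)" "(\<Sum>i. diameter (C i) powr s) < e"
    using hausdorff_null_cover[OF null e] by blast
  \<comment> \<open>Cover sets may have diameter 0; the geometric term makes every
    \<open>r i\<close> positive and adds only e in total.\<close>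
  define v where "v = (\<lambda>i. diameter (C i) powr s + e * (1/2)^Suc i)"
  define r where "r = (\<lambda>i. v i powr (1 / s))"
  have v0: "0 < v i" for i unfolding v_def using e by (intro add_nonneg_pos) auto
  have rs: "r i powr s = v i" for i unfolding r_def using s v0[of i] by (simp add: powr_powr)
  have r0: "0 < r i" for i unfolding r_def using v0[of i] by simp
  have half: "(\<lambda>i. e * (1/2)^Suc i) sums e" using sums_mult[OF power_half_series, of e] by simp
  have vsm: "summable v" unfolding v_def using C(3) half by (intro summable_add) (auto simp: sums_iff)
  have vsum: "suminf v < 2 * e"
    unfolding v_def using suminf_add[OF C(3) sums_summable[OF half]] C(4) sums_unique[OF half] by simp
  have v_le: "v i \<le> suminf v" for i
    using sum_le_suminf[OF vsm, of "{i}"] v0 by (simp add: less_imp_le)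
  have "r i powr s < d K powr s" for i
    unfolding rs using v_le[of i] vsum e e_le(1) by linarith
  then have rd: "r i < d K" for i using s r0[of i] by (simp add: powr_less_cancel2 less_imp_le)
  have gr: "c * d k powr w \<le> d (Suc k)" if "K \<le> k" for k using c(2) K(1) that by simp
  have "\<forall>i. \<exists>k. K \<le> k \<and> (r i + 4 * d k) / sqrt (d k) \<le> M * v i"
  proof
    fix i
    obtain k where "K \<le> k" "(r i + 4 * d k) / sqrt (d k) \<le> 5 * c powr (- (1 / (1 + w)) / 2) * r i powr (1 / (1 + w))"
      using level_for_diameter[OF c(1) w gr r0 rd] by blast
    then show "\<exists>k. K \<le> k \<and> (r i + 4 * d k) / sqrt (d k) \<le> M * v i"
      unfolding s_def[symmetric] rs M_def by blast
  qed
  then obtain l where l: "\<And>i. K \<le> l i" "\<And>i. (r i + 4 * d (l i)) / sqrt (d (l i)) \<le> M * v i" by metis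
  let ?cost = "\<lambda>i. (r i + 4 * d (l i)) / sqrt (d (l i))"
  have cost0: "0 \<le> ?cost i" for i using less_imp_le[OF r0[of i]] less_imp_le[OF d_pos[of "l i"]] by simp
  have Mv: "summable (\<lambda>i. M * v i)" using vsm by (rule summable_mult)
  have csm: "summable ?cost"
  proof (rule summable_comparison_test'[OF Mv, of 0])
    show "norm (?cost i) \<le> M * v i" for i
      unfolding real_norm_def abs_of_nonneg[OF cost0] by (rule l(2))
  qed
  have "suminf ?cost \<le> (\<Sum>i. M * v i)" by (rule suminf_le[OF l(2) csm Mv])
  also have "\<dots> = M * suminf v" using vsm by (rule suminf_mult)
  also have "\<dots> < M * (2 * e)" using vsum M by simp
  also have "\<dots> \<le> M * (node_weight K n0 / M)"
  proof -
    have "2 * e \<le> node_weight K n0 / M" using e_le(2) e by linarith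
    then show ?thesis using M by (intro mult_left_mono) auto
  qed
  also have "\<dots> = node_weight K n0" using M by simp
  finally have csum: "suminf ?cost < node_weight K n0" .
  have sub: "C i \<subseteq> {Inf (C i)..Inf (C i) + r i}" for i
  proof
    fix x assume x: "x \<in> C i"
    have bdd: "bdd_below (C i)" using C(1) by (rule bounded_imp_bdd_below)
    have "diameter (C i) = (diameter (C i) powr s) powr (1 / s)"
      using s diameter_ge_0[OF C(1)[of i]] by (simp add: powr_powr)
    also have "\<dots> \<le> r i"
      unfolding r_def v_def using s e by (intro powr_mono2) auto
    finally have dr: "diameter (C i) \<le> r i" .
    have "x - r i \<le> Inf (C i)"
    proof (rule cInf_greatest)
      show "C i \<noteq> {}" using x by blast
      fix z assume "z \<in> C i"
      then have "dist x z \<le> diameter (C i)" using diameter_bounded_bound[OF C(1)] x by blast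
      then show "x - r i \<le> z" using dr by (simp add: dist_real_def)
    qed
    then show "x \<in> {Inf (C i)..Inf (C i) + r i}" using cInf_lower[OF x bdd] by simp
  qed
  obtain y where y: "y \<in> segment K n0" "\<And>j. K \<le> j \<Longrightarrow> reached j y" "\<And>i. y \<notin> C i"
    using uncovered_reached_point[where C = C and \<alpha> = "\<lambda>i. Inf (C i)" and r = r and l = l,
      OF sub less_imp_le[OF r0] l(1) csm csum root] by blast
  have "y \<in> U1 \<theta>" using y seg by (intro U1_if_reached[of y K]) auto
  then show False using C(2) y(3) by blast
qed

end

theorem mainTheorem6:
  fixes \<theta> :: real
  assumes "\<theta> \<notin> \<rat>" and "0 < \<theta>" and "\<theta> < 1"
  shows "ereal (hausdorff_dim (U1 \<theta>)) \<ge>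
           (if irr_exp \<theta> = \<infinity> then 0 else ereal (1 / (real_of_ereal (irr_exp \<theta>) + 1)))"
proof -
  interpret irrational_rotation \<theta> by unfold_locales (use assms in auto)
  let ?S = "{s. s > 0 \<and> hausdorff_measure s (U1 \<theta>) = 0}"
  have "U1 \<theta> \<subseteq> {0..<1}" unfolding U1_def by blast
  then have "2 \<in> ?S" using hausdorff_measure_2_unit_interval by simp
  then have ne: "?S \<noteq> {}" by blast
  show ?thesis
  proof (cases "irr_exp \<theta> = \<infinity>")
    case True
    have "0 \<le> Inf ?S" by (rule cInf_greatest[OF ne]) auto
    then show ?thesis using True unfolding hausdorff_dim_def by simp
  next
    case False
    then obtain w where w: "irr_exp \<theta> = ereal w" using irr_exp_ge_half by (cases "irr_exp \<theta>") auto
    have w0: "0 < w" using irr_exp_ge_half unfolding w by simp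
    have "1 / (w + 1) \<le> t" if t: "t \<in> ?S" for t
    proof (rule ccontr)
      assume "\<not> 1 / (w + 1) \<le> t"
      then have lt: "t < 1 / (w + 1)" by simp
      have t0: "0 < t" using t by simp
      \<comment> \<open>This v solves t = 1 / (1 + v); it exceeds w, so its lower limit cannot
        vanish.\<close>
      define v where "v = 1 / t - 1"
      have wv: "w < v" unfolding v_def using lt t0 w0 by (simp add: field_simps)
      then have v0: "0 < v" using w0 by simp
      have tv: "t = 1 / (1 + v)" unfolding v_def using t0 by simp
      have "Liminf sequentially (\<lambda>j::nat. ereal (real j powr v * dnint (real j * \<theta>))) \<noteq> 0"
      proof
        assume "Liminf sequentially (\<lambda>j::nat. ereal (real j powr v * dnint (real j * \<theta>))) = 0"
        then have "ereal v \<le> irr_exp \<theta>" unfolding irr_exp_def using v0 by (intro Sup_upper) blast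
        then show False using wv unfolding w by simp
      qed
      then obtain c K where "0 < c" "\<And>k. K \<le> k \<Longrightarrow> c * d k powr v \<le> d (Suc k)"
        using err_lower_bound[OF v0] by blast
      then have "hausdorff_measure t (U1 \<theta>) \<noteq> 0"
        unfolding tv using hausdorff_measure_U1_nonzero[OF v0] by blast
      then show False using t by simp
    qed
    then have "1 / (w + 1) \<le> Inf ?S" by (intro cInf_greatest[OF ne])
    then show ?thesis using False unfolding w hausdorff_dim_def by simp
  qed
qed

end
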